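(* There is a polynomial-time algorithm that, given a forest $F$ and a linear order $\sigma$ on $V(F)$, computes ${\rm GDN}(F,\sigma)$.
   Context: For a graph $G$ with linear order $\sigma$ on $V(G)$, and a set $S\subseteq V(G)$ together with an assignment of colors to the vertices of $S$, the greedy (first-fit) coloring of $(G,\sigma)$ fixing $S$ proceeds as follows: the vertices of $S$ keep their assigned colors throughout; the vertices not in $S$ are processed in the order $\sigma$, and each receives the smallest positive integer color not used by any already-colored neighbor (neighbors in $S$ count as colored from the start). A greedy defining set of $(G,\sigma)$ is a set $S$ with a color assignment such that this procedure yields a proper coloring of $G$ with $\chi(G)$ colors. ${\rm GDN}(G,\sigma)$ is the minimum cardinality of a greedy defining set of $(G,\sigma)$. *)

theory Defs
  imports "HOL-Combinatorics.Multiset_Permutations" "HOL-Computational_Algebra.Polynomial"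
begin

section \<open>Forests and chromatic number\<close>

definition simple_graph :: "'a set \<Rightarrow> 'a set set \<Rightarrow> bool" where
  "simple_graph V E \<longleftrightarrow> finite V \<and> (\<forall>e\<in>E. \<exists>u\<in>V. \<exists>v\<in>V. u \<noteq> v \<and> e = {u, v})"

definition is_cycle :: "'a set set \<Rightarrow> 'a list \<Rightarrow> bool" where
  "is_cycle E xs \<longleftrightarrow> 3 \<le> length xs \<and> distinct xs \<and>
     (\<forall>i<length xs. {xs ! i, xs ! (Suc i mod length xs)} \<in> E)"

definition forest :: "'a set \<Rightarrow> 'a set set \<Rightarrow> bool" where
  "forest V E \<longleftrightarrow> simple_graph V E \<and> (\<nexists>xs. is_cycle E xs)"

definition proper_coloring :: "'a set \<Rightarrow> 'a set set \<Rightarrow> ('a \<Rightarrow> nat) \<Rightarrow> bool" where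
  "proper_coloring V E c \<longleftrightarrow>
     (\<forall>v\<in>V. 0 < c v) \<and> (\<forall>u\<in>V. \<forall>v\<in>V. {u, v} \<in> E \<longrightarrow> c u \<noteq> c v)"

definition chromatic_number :: "'a set \<Rightarrow> 'a set set \<Rightarrow> nat" where
  "chromatic_number V E = (LEAST k. \<exists>c. proper_coloring V E c \<and> card (c ` V) = k)"

section \<open>Greedy defining sets\<close>

text \<open>A partial map \<open>c\<close> records the vertices colored so far. The set \<open>S\<close> together with its
  color assignment is a partial map \<open>p\<close> with \<open>dom p = S\<close>. A linear order on the finite set \<open>V\<close> is
  given by the list of all vertices in increasing order, an element of \<open>permutations_of_set V\<close>.\<close>

definition color_vertex :: "'a set set \<Rightarrow> 'a \<Rightarrow> ('a \<rightharpoonup> nat) \<Rightarrow> ('a \<rightharpoonup> nat)" where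
  "color_vertex E v c = c(v \<mapsto> (LEAST k. 0 < k \<and> (\<forall>u. {u, v} \<in> E \<longrightarrow> c u \<noteq> Some k)))"

definition greedy_coloring :: "'a set set \<Rightarrow> 'a list \<Rightarrow> ('a \<rightharpoonup> nat) \<Rightarrow> ('a \<rightharpoonup> nat)" where
  "greedy_coloring E \<sigma> p = fold (color_vertex E) (filter (\<lambda>v. v \<notin> dom p) \<sigma>) p"

definition greedy_defining_set ::
    "'a set \<Rightarrow> 'a set set \<Rightarrow> 'a list \<Rightarrow> ('a \<rightharpoonup> nat) \<Rightarrow> bool" where
  "greedy_defining_set V E \<sigma> p \<longleftrightarrow>
     dom p \<subseteq> V \<and> (\<forall>k\<in>ran p. 0 < k) \<and>
     (let c = (\<lambda>v. the (greedy_coloring E \<sigma> p v))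
      in proper_coloring V E c \<and> card (c ` V) = chromatic_number V E)"

definition GDN :: "'a set \<Rightarrow> 'a set set \<Rightarrow> 'a list \<Rightarrow> nat" where
  "GDN V E \<sigma> = (LEAST k. \<exists>p. greedy_defining_set V E \<sigma> p \<and> card (dom p) = k)"

section \<open>Polynomial-time computation\<close>

text \<open>Algorithms are programs of a random access machine in structured form. The memory consists
  of unbounded arrays of natural numbers; a program refers to arrays by literal names, hence to
  finitely many of them, while indices are computed. Every assignment and every test costs one
  unit. The only arithmetic is addition and truncated subtraction, so the bit length of the
  numbers in memory grows by at most a constant (depending on the program) per unit of time; this
  makes polynomial time in this model the same as polynomial time on Turing machines.\<close>

datatype expr =
    Const nat
  | Cell nat expr \<comment> \<open>array name, index\<close>
  | Plus expr expr
  | Minus expr expr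

datatype com =
    Skip
  | Assign nat expr expr \<comment> \<open>array name, index, new value\<close>
  | Seq com com
  | Cond expr com com
  | While expr com

type_synonym memory = "nat \<Rightarrow> nat \<Rightarrow> nat"

fun eval_expr :: "expr \<Rightarrow> memory \<Rightarrow> nat" where
  "eval_expr (Const n) s = n"
| "eval_expr (Cell a e) s = s a (eval_expr e s)"
| "eval_expr (Plus e1 e2) s = eval_expr e1 s + eval_expr e2 s"
| "eval_expr (Minus e1 e2) s = eval_expr e1 s - eval_expr e2 s"

text \<open>\<open>exec c s t s'\<close>: started in memory \<open>s\<close>, the program \<open>c\<close> halts after \<open>t\<close> units of time
  in memory \<open>s'\<close>. Tests succeed iff the expression is nonzero.\<close>

inductive exec :: "com \<Rightarrow> memory \<Rightarrow> nat \<Rightarrow> memory \<Rightarrow> bool" where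
  Skip: "exec Skip s 1 s"
| Assign: "exec (Assign a i e) s 1 (s(a := (s a)(eval_expr i s := eval_expr e s)))"
| Seq: "exec c1 s1 t1 s2 \<Longrightarrow> exec c2 s2 t2 s3 \<Longrightarrow> exec (Seq c1 c2) s1 (t1 + t2) s3"
| CondTrue: "eval_expr e s \<noteq> 0 \<Longrightarrow> exec c1 s t s' \<Longrightarrow> exec (Cond e c1 c2) s (1 + t) s'"
| CondFalse: "eval_expr e s = 0 \<Longrightarrow> exec c2 s t s' \<Longrightarrow> exec (Cond e c1 c2) s (1 + t) s'"
| WhileFalse: "eval_expr e s = 0 \<Longrightarrow> exec (While e c) s 1 s"
| WhileTrue: "eval_expr e s1 \<noteq> 0 \<Longrightarrow> exec c s1 t1 s2 \<Longrightarrow> exec (While e c) s2 t2 s3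
    \<Longrightarrow> exec (While e c) s1 (1 + t1 + t2) s3"

definition initial_memory :: "nat list \<Rightarrow> memory" where
  "initial_memory xs = (\<lambda>a i. if a = 0 \<and> i < length xs then xs ! i else 0)"

text \<open>One program and one polynomial serve all instances in \<open>D\<close>; the result is read off from
  cell 0 of array 1. Time is bounded in the number of input cells, which is at most the bit length
  of the input.\<close>

definition poly_time_computable :: "('i \<Rightarrow> nat list) \<Rightarrow> 'i set \<Rightarrow> ('i \<Rightarrow> nat) \<Rightarrow> bool" where
  "poly_time_computable enc D f \<longleftrightarrow>
     (\<exists>c. \<exists>q :: nat poly. \<forall>x\<in>D. \<exists>t s.
        exec c (initial_memory (enc x)) t s \<and> t \<le> poly q (length (enc x)) \<and> s 1 0 = f x)"

text \<open>A graph on the vertices \<open>0, \<dots>, n - 1\<close> with a vertex order is encoded by \<open>n\<close>, followed by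
  the list \<open>\<sigma>\<close>, followed by the rows of the adjacency matrix.\<close>

definition encode :: "nat \<times> nat set set \<times> nat list \<Rightarrow> nat list" where
  "encode = (\<lambda>(n, E, \<sigma>).
     n # \<sigma> @ concat (map (\<lambda>u. map (\<lambda>v. if {u, v} \<in> E then 1 else 0) [0..<n]) [0..<n]))"

end

theory Submission
  imports Defs
begin

text \<open>The colors may be assumed to be 1 and 2. Given the final proper coloring, a set \<open>S\<close> with the
  induced colors is a greedy defining set iff every vertex outside \<open>S\<close> of color 2 has a neighbor that
  is in \<open>S\<close> or earlier in the order: that neighbor has color 1. So \<open>S\<close> must cover, by itself or by
  a neighbor, every color-2 vertex that precedes all its neighbors. In a forest an optimal pair of a
  coloring and a covering set is found by repeatedly removing a vertex with at most one remaining
  neighbor: if it needs to be covered and is not yet, its remaining neighbor is marked as selected;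
  in any case its costs for the two colors are swapped and added to those of that neighbor. When
  there is no remaining neighbor, the cheaper coloring of the component is chosen.\<close>

section \<open>Optimal covers of forests\<close>

text \<open>A 2-coloring \<open>c\<close> of the remaining vertices \<open>R\<close> (true stands for color 2) is extended by a
  set \<open>S\<close> of fixed vertices that covers the color-2 vertices of \<open>B\<close>. The subtree already cut off
  below \<open>x\<close> costs \<open>a x\<close> if \<open>x\<close> gets color 2 and \<open>b x\<close> if it gets color 1. Marked vertices \<open>M\<close>
  cover their neighbors for free: their price is contained in those costs.\<close>

definition solvable ::
    "'a set set \<Rightarrow> 'a set \<Rightarrow> 'a set \<Rightarrow> 'a set \<Rightarrow> ('a \<Rightarrow> nat) \<Rightarrow> ('a \<Rightarrow> nat) \<Rightarrow> nat \<Rightarrow> bool" where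
  "solvable E B R M a b k \<longleftrightarrow> (\<exists>c S. S \<subseteq> R \<and>
     (\<forall>x\<in>R. \<forall>y\<in>R. {x, y} \<in> E \<longrightarrow> c x \<noteq> c y) \<and>
     (\<forall>x\<in>R \<inter> B. c x \<longrightarrow> x \<in> S \<or> (\<exists>y\<in>S \<union> M. {x, y} \<in> E)) \<and>
     card S + (\<Sum>x\<in>R. if c x then a x else b x) \<le> k)"

lemma solvableI:
  assumes "S \<subseteq> R"
    and "\<And>x y. x \<in> R \<Longrightarrow> y \<in> R \<Longrightarrow> {x, y} \<in> E \<Longrightarrow> c x \<noteq> c y"
    and "\<And>x. x \<in> R \<Longrightarrow> x \<in> B \<Longrightarrow> c x \<Longrightarrow> x \<in> S \<or> (\<exists>y\<in>S \<union> M. {x, y} \<in> E)"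
    and "card S + (\<Sum>x\<in>R. if c x then a x else b x) \<le> k"
  shows "solvable E B R M a b k"
  unfolding solvable_def using assms(1,4)
  by (intro exI[of _ c] exI[of _ S] conjI ballI impI assms(2,3)) auto

lemma solvableE:
  assumes "solvable E B R M a b k"
  obtains c S where "S \<subseteq> R"
    and "\<And>x y. x \<in> R \<Longrightarrow> y \<in> R \<Longrightarrow> {x, y} \<in> E \<Longrightarrow> c x \<noteq> c y"
    and "\<And>x. x \<in> R \<Longrightarrow> x \<in> B \<Longrightarrow> c x \<Longrightarrow> x \<in> S \<or> (\<exists>y\<in>S \<union> M. {x, y} \<in> E)"
    and "card S + (\<Sum>x\<in>R. if c x then a x else b x) \<le> k"
proof -
  obtain c S where "S \<subseteq> R"
    and "\<forall>x\<in>R. \<forall>y\<in>R. {x, y} \<in> E \<longrightarrow> c x \<noteq> c y"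
    and "\<forall>x\<in>R \<inter> B. c x \<longrightarrow> x \<in> S \<or> (\<exists>y\<in>S \<union> M. {x, y} \<in> E)"
    and "card S + (\<Sum>x\<in>R. if c x then a x else b x) \<le> k"
    using assms unfolding solvable_def by (elim exE conjE)
  then show thesis by (intro that[of S c]) simp_all
qed

lemma solvable_empty: "solvable E B {} M a b k"
  unfolding solvable_def by auto

text \<open>If \<open>v\<close> has color 2 and must be covered, then \<open>u\<close> is at least as good a choice as \<open>v\<close>
  because \<open>u\<close> is the only remaining vertex that \<open>v\<close> could cover. Then \<open>u\<close> has color 1, and this
  choice is paid for in the cost of color 1 at \<open>u\<close>.\<close>

lemma solvable_remove_leaf:
  assumes fin: "finite R" and v: "v \<in> R" and nb: "{w \<in> R. {v, w} \<in> E} = {u}"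
    and loop: "\<And>x. {x} \<notin> E"
    and pick: "pick \<longleftrightarrow> v \<in> B \<and> \<not> (\<exists>y\<in>M. {v, y} \<in> E)"
    and M': "M' = (if pick then insert u M else M)"
    and a': "a' u = a u + b v" "\<And>x. x \<in> R \<Longrightarrow> x \<noteq> v \<Longrightarrow> x \<noteq> u \<Longrightarrow> a' x = a x"
    and b': "b' u = b u + (a v + of_bool pick)"
      "\<And>x. x \<in> R \<Longrightarrow> x \<noteq> v \<Longrightarrow> x \<noteq> u \<Longrightarrow> b' x = b x"
  shows "solvable E B R M a b k \<longleftrightarrow> solvable E B (R - {v}) M' a' b' k"
proof -
  have u: "u \<in> R" "{v, u} \<in> E" and uniq: "\<And>w. w \<in> R \<Longrightarrow> {v, w} \<in> E \<Longrightarrow> w = u"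
    using nb by auto
  have uv: "u \<noteq> v" using u(2) loop[of v] by auto
  have uniq': "\<And>w. w \<in> R \<Longrightarrow> {w, v} \<in> E \<Longrightarrow> w = u"
    using uniq by (simp add: insert_commute)
  \<comment> \<open>Exactly one of \<open>u\<close> and \<open>v\<close> has color 2, so the color
    of \<open>u\<close> decides which cost of \<open>v\<close> is due. The surcharge sits in the
    color-1 cost of \<open>u\<close> because that is the case in which \<open>v\<close> has color
    2.\<close>
  have cost: "(\<Sum>x\<in>R - {v}. if c x then a' x else b' x) =
      (\<Sum>x\<in>R. if c x then a x else b x) + of_bool (pick \<and> c v)" if "c v \<noteq> c u" for c
  proof -
    have "(\<Sum>x\<in>R - {v}. if c x then a' x else b' x) =
      (if c u then a' u else b' u) + (\<Sum>x\<in>R - {v} - {u}. if c x then a' x else b' x)"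
      using fin u uv by (subst sum.remove[of _ u]) auto
    also have "(\<Sum>x\<in>R - {v} - {u}. if c x then a' x else b' x) =
        (\<Sum>x\<in>R - {v} - {u}. if c x then a x else b x)"
      using a' b' by (intro sum.cong) auto
    finally have 1: "(\<Sum>x\<in>R - {v}. if c x then a' x else b' x) =
      (if c u then a' u else b' u) + (\<Sum>x\<in>R - {v} - {u}. if c x then a x else b x)" .
    have "(\<Sum>x\<in>R. if c x then a x else b x) = (if c v then a v else b v) +
       ((if c u then a u else b u) + (\<Sum>x\<in>R - {v} - {u}. if c x then a x else b x))"
      using fin u uv v by (simp add: sum.remove[of R v] sum.remove[of "R - {v}" u])
    with 1 that show ?thesis using a'(1) b'(1) by auto
  qed
  show ?thesis
  proof
    assume "solvable E B R M a b k"
    then obtain c S where S: "S \<subseteq> R"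
      and proper: "\<And>x y. x \<in> R \<Longrightarrow> y \<in> R \<Longrightarrow> {x, y} \<in> E \<Longrightarrow> c x \<noteq> c y"
      and dom: "\<And>x. x \<in> R \<Longrightarrow> x \<in> B \<Longrightarrow> c x \<Longrightarrow> x \<in> S \<or> (\<exists>y\<in>S \<union> M. {x, y} \<in> E)"
      and k: "card S + (\<Sum>x\<in>R. if c x then a x else b x) \<le> k"
      by (rule solvableE) blast
    have cuv: "c v \<noteq> c u" using proper[OF v u] by simp
    have finS: "finite S" using S fin finite_subset by blast
    \<comment> \<open>First case: \<open>u\<close> is now marked, so its removal from
      \<open>S\<close> uncovers nothing. Second case: \<open>u\<close> has color 2 and may rely on
      \<open>v\<close> for its cover, so it takes the place of \<open>v\<close>. Otherwise
      \<open>v\<close>, if selected at all, covers no remaining vertex of color 2 except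
      itself.\<close>
    define S' where "S' = (if pick \<and> c v then S - {u, v}
        else if v \<in> S \<and> c u then insert u (S - {v}) else S - {v})"
    have card: "card S' + of_bool (pick \<and> c v) \<le> card S"
    proof (cases "pick \<and> c v")
      case True
      \<comment> \<open>No marked vertex is adjacent to \<open>v\<close>, so its cover comes from
        \<open>S\<close>. The selected vertex dropped here pays for the surcharge.\<close>
      then have "v \<in> S \<or> u \<in> S"
        using dom[of v] v pick uniq S by blast
      then have "S - {u, v} \<subset> S" by auto
      then show ?thesis using True psubset_card_mono[OF finS] by (simp add: S'_def Suc_leI)
    next
      case False
      have "card (insert u (S - {v})) \<le> card S" if "v \<in> S"
        using card_insert_le_m1[of "card S" "S - {v}" u] that finS
        by (metis card.remove card_insert_if finite_Diff le_SucI le_refl)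
      then show ?thesis using False finS by (auto simp: S'_def card_Diff1_le)
    qed
    have sub: "S' \<subseteq> R - {v}" using S u uv by (auto simp: S'_def)
    have dom': "x \<in> S' \<or> (\<exists>y\<in>S' \<union> M'. {x, y} \<in> E)"
      if x: "x \<in> R" "x \<noteq> v" "x \<in> B" "c x" for x
    proof (cases "c v")
      case True
      then have "x \<noteq> u" using x cuv by auto
      then have "{x, v} \<notin> E" using uniq' x by auto
      then show ?thesis using dom[OF x(1,3,4)] \<open>x \<noteq> u\<close> x(2) True by (auto simp: S'_def M')
    next
      case False
      then have cu: "c u" using cuv by auto
      show ?thesis
      proof (cases "x = u")
        case True
        have uve: "{u, v} \<in> E" using u(2) by (simp add: insert_commute)
        show ?thesis using dom[OF x(1,3,4)] True cu False uve by (auto simp: S'_def M')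
      next
        case xu: False
        then have "{x, v} \<notin> E" using uniq' x by auto
        then show ?thesis using dom[OF x(1,3,4)] xu x(2) False cu by (auto simp: S'_def M')
      qed
    qed
    show "solvable E B (R - {v}) M' a' b' k"
      using card k cost[OF cuv] by (intro solvableI[OF sub proper dom']) auto
  next
    assume "solvable E B (R - {v}) M' a' b' k"
    then obtain c S where S: "S \<subseteq> R - {v}"
      and proper: "\<And>x y. x \<in> R - {v} \<Longrightarrow> y \<in> R - {v} \<Longrightarrow> {x, y} \<in> E \<Longrightarrow> c x \<noteq> c y"
      and dom: "\<And>x. x \<in> R - {v} \<Longrightarrow> x \<in> B \<Longrightarrow> c x \<Longrightarrow> x \<in> S \<or> (\<exists>y\<in>S \<union> M'. {x, y} \<in> E)"
      and k: "card S + (\<Sum>x\<in>R - {v}. if c x then a' x else b' x) \<le> k"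
      by (rule solvableE) blast
    define d where "d = c(v := \<not> c u)"
    \<comment> \<open>The mark on \<open>u\<close> is turned back into a selected vertex, but only
      if \<open>v\<close> has color 2; this is exactly when the surcharge has been paid.\<close>
    define S' where "S' = (if pick \<and> d v then insert u S else S)"
    have duv: "d v \<noteq> d u" using uv by (simp add: d_def)
    have k': "card S + ((\<Sum>x\<in>R. if d x then a x else b x) + of_bool (pick \<and> d v)) \<le> k"
    proof -
      have "(\<Sum>x\<in>R - {v}. if d x then a' x else b' x) = (\<Sum>x\<in>R - {v}. if c x then a' x else b' x)"
        by (intro sum.cong) (auto simp: d_def)
      then show ?thesis using k unfolding cost[OF duv, symmetric] by simp
    qed
    have "card S' \<le> card S + of_bool (pick \<and> d v)"
      using card_insert_le_m1 by (simp add: S'_def card_insert_if finite_subset[OF S] fin)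
    then have k'': "card S' + (\<Sum>x\<in>R. if d x then a x else b x) \<le> k" using k' by linarith
    have proper': "d x \<noteq> d y" if xy: "x \<in> R" "y \<in> R" "{x, y} \<in> E" for x y
    proof -
      have "x \<noteq> y" using xy loop[of x] by auto
      then show ?thesis using proper[of x y] uniq[of y] uniq'[of x] xy uv
        by (auto simp: d_def)
    qed
    have dom': "x \<in> S' \<or> (\<exists>y\<in>S' \<union> M. {x, y} \<in> E)" if x: "x \<in> R" "x \<in> B" "d x" for x
    proof (cases "x = v")
      case True
      then show ?thesis using x pick u(2) by (auto simp: S'_def)
    next
      case False
      then have "x \<in> S \<or> (\<exists>y\<in>S \<union> M'. {x, y} \<in> E)" using dom[of x] x by (auto simp: d_def)
      \<comment> \<open>If \<open>x\<close> is covered only by the new mark on \<open>u\<close>,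
        then \<open>u\<close> has color 1, hence \<open>v\<close> has color 2 and \<open>u\<close>
        belongs to \<open>S'\<close>.\<close>
      moreover have "{x, u} \<in> E \<Longrightarrow> \<not> d u" using proper'[of x u] x u by auto
      ultimately show ?thesis using duv by (auto simp: S'_def M' split: if_splits)
    qed
    show "solvable E B R M a b k"
      using S u by (intro solvableI[OF _ proper' dom' k'']) (auto simp: S'_def)
  qed
qed

text \<open>With no neighbor in \<open>R\<close>, the color of \<open>v\<close> is free and only
  \<open>v\<close> can provide a missing cover. The cheaper color is therefore optimal, where color
  2 costs one more if \<open>v\<close> still needs a cover. The inequality stands beside the
  truncated difference because the latter alone would hide a bound that is too small.\<close>

lemma solvable_remove_isolated:
  assumes fin: "finite R" and v: "v \<in> R" and nb: "{w \<in> R. {v, w} \<in> E} = {}"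
    and pick: "pick \<longleftrightarrow> v \<in> B \<and> \<not> (\<exists>y\<in>M. {v, y} \<in> E)"
    and a': "\<And>x. x \<in> R \<Longrightarrow> x \<noteq> v \<Longrightarrow> a' x = a x"
  shows "solvable E B R M a b k \<longleftrightarrow>
    min (a v + of_bool pick) (b v) \<le> k \<and>
    solvable E B (R - {v}) M a' b (k - min (a v + of_bool pick) (b v))"
proof -
  have no: "\<And>w. w \<in> R \<Longrightarrow> {v, w} \<notin> E" "\<And>w. w \<in> R \<Longrightarrow> {w, v} \<notin> E"
    using nb by (auto simp: insert_commute)
  have sum: "(\<Sum>x\<in>R. if c x then a x else b x) =
      (if c v then a v else b v) + (\<Sum>x\<in>R - {v}. if c x then a' x else b x)" for c
  proof -
    have "(\<Sum>x\<in>R - {v}. if c x then a' x else b x) = (\<Sum>x\<in>R - {v}. if c x then a x else b x)"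
      using a' by (intro sum.cong) auto
    then show ?thesis using fin v by (simp add: sum.remove[of R v])
  qed
  show ?thesis
  proof
    assume "solvable E B R M a b k"
    then obtain c S where S: "S \<subseteq> R"
      and proper: "\<And>x y. x \<in> R \<Longrightarrow> y \<in> R \<Longrightarrow> {x, y} \<in> E \<Longrightarrow> c x \<noteq> c y"
      and dom: "\<And>x. x \<in> R \<Longrightarrow> x \<in> B \<Longrightarrow> c x \<Longrightarrow> x \<in> S \<or> (\<exists>y\<in>S \<union> M. {x, y} \<in> E)"
      and k: "card S + (\<Sum>x\<in>R. if c x then a x else b x) \<le> k"
      by (rule solvableE) blast
    have finS: "finite S" using S fin finite_subset by blast
    have "v \<in> S" if "pick" "c v"
      using dom[OF v] that no(1) S unfolding pick by blast
    then have "card (S - {v}) + of_bool (pick \<and> c v) \<le> card S"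
      using finS by (auto simp: card_Diff1_le card_Suc_Diff1 simp del: card_Diff_insert)
    then have k': "min (a v + of_bool pick) (b v) +
        (card (S - {v}) + (\<Sum>x\<in>R - {v}. if c x then a' x else b x)) \<le> k"
      using k unfolding sum by (auto split: if_splits)
    then have "solvable E B (R - {v}) M a' b (k - min (a v + of_bool pick) (b v))"
    proof (intro solvableI)
      show "x \<in> S - {v} \<or> (\<exists>y\<in>S - {v} \<union> M. {x, y} \<in> E)" if "x \<in> R - {v}" "x \<in> B" "c x" for x
        using dom[of x] that no(2)[of x] by blast
    qed (use S proper in auto)
    then show "min (a v + of_bool pick) (b v) \<le> k \<and>
      solvable E B (R - {v}) M a' b (k - min (a v + of_bool pick) (b v))" using k' by auto
  next
    assume asm: "min (a v + of_bool pick) (b v) \<le> k \<and>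
      solvable E B (R - {v}) M a' b (k - min (a v + of_bool pick) (b v))"
    from conjunct2[OF this] obtain c S where S: "S \<subseteq> R - {v}"
      and proper: "\<And>x y. x \<in> R - {v} \<Longrightarrow> y \<in> R - {v} \<Longrightarrow> {x, y} \<in> E \<Longrightarrow> c x \<noteq> c y"
      and dom: "\<And>x. x \<in> R - {v} \<Longrightarrow> x \<in> B \<Longrightarrow> c x \<Longrightarrow> x \<in> S \<or> (\<exists>y\<in>S \<union> M. {x, y} \<in> E)"
      and k: "card S + (\<Sum>x\<in>R - {v}. if c x then a' x else b x)
        \<le> k - min (a v + of_bool pick) (b v)"
      by (rule solvableE) blast
    define d where "d = c(v := (a v + of_bool pick \<le> b v))"
    define S' where "S' = (if pick \<and> d v then insert v S else S)"
    have "card S' \<le> card S + of_bool (pick \<and> d v)"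
      by (simp add: S'_def card_insert_if finite_subset[OF S] fin)
    moreover have "(\<Sum>x\<in>R. if d x then a x else b x) =
        (if d v then a v else b v) + (\<Sum>x\<in>R - {v}. if c x then a' x else b x)"
    proof -
      have "(\<Sum>x\<in>R - {v}. if d x then a' x else b x) = (\<Sum>x\<in>R - {v}. if c x then a' x else b x)"
        by (intro sum.cong) (auto simp: d_def)
      then show ?thesis unfolding sum by simp
    qed
    ultimately have k': "card S' + (\<Sum>x\<in>R. if d x then a x else b x) \<le> k"
      using k asm by (auto simp: d_def min_def split: if_splits)
    show "solvable E B R M a b k"
    proof (rule solvableI)
      show "S' \<subseteq> R" using S v by (auto simp: S'_def)
      show "d x \<noteq> d y" if "x \<in> R" "y \<in> R" "{x, y} \<in> E" for x y
        using that proper[of x y] no by (auto simp: d_def)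
      show "x \<in> S' \<or> (\<exists>y\<in>S' \<union> M. {x, y} \<in> E)" if "x \<in> R" "x \<in> B" "d x" for x
        using that dom[of x] pick by (cases "x = v") (auto simp: d_def S'_def)
    qed (rule k')
  qed
qed

section \<open>Vertices of degree at most one in acyclic graphs\<close>

lemma forest_no_loop: "forest V E \<Longrightarrow> {x} \<notin> E"
  by (fastforce simp: forest_def simple_graph_def singleton_insert_inj_eq)

text \<open>Take a longest path in \<open>R\<close>. All neighbors in \<open>R\<close> of its first
  vertex lie on it, and if there are at least two of them, one is not the second vertex of the path
  and closes a cycle.\<close>

lemma forest_leaf:
  assumes "forest V E" "R \<subseteq> V" "R \<noteq> {}"
  shows "\<exists>v\<in>R. card {w \<in> R. {v, w} \<in> E} \<le> 1"
proof (rule ccontr)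
  assume "\<not> ?thesis"
  then have deg: "\<And>v. v \<in> R \<Longrightarrow> 2 \<le> card {w \<in> R. {v, w} \<in> E}" by force
  have fin: "finite R" and nocyc: "\<And>xs. \<not> is_cycle E xs"
    using assms finite_subset by (auto simp: forest_def simple_graph_def)
  have loop: "{x} \<notin> E" for x
    using assms(1) by (rule forest_no_loop)
  have other: "\<exists>w\<in>R. {v, w} \<in> E \<and> w \<noteq> z" if "v \<in> R" for v z
  proof (rule ccontr)
    assume "\<not> ?thesis"
    then have "{w \<in> R. {v, w} \<in> E} \<subseteq> {z}" by auto
    then have "card {w \<in> R. {v, w} \<in> E} \<le> card {z}" by (intro card_mono) auto
    then show False using deg[OF that] by simp
  qed
  define path where "path xs \<longleftrightarrow> xs \<noteq> [] \<and> distinct xs \<and> set xs \<subseteq> R \<and>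
    (\<forall>i. Suc i < length xs \<longrightarrow> {xs ! i, xs ! Suc i} \<in> E)" for xs
  obtain r where "r \<in> R" using assms(3) by auto
  then have "path [r]" by (simp add: path_def)
  moreover have "length xs < Suc (card R)" if "path xs" for xs
    using that card_mono[OF fin, of "set xs"] distinct_card[of xs] unfolding path_def by linarith
  ultimately obtain xs where xs: "path xs" and max: "\<And>ys. path ys \<Longrightarrow> length ys \<le> length xs"
    using Lattices_Big.ex_has_greatest_nat[of path "[r]" length "Suc (card R)"] by blast
  then obtain x ys where xs_eq: "xs = x # ys" by (cases xs) (auto simp: path_def)
  have closed: "w \<in> set xs" if "w \<in> R" "{x, w} \<in> E" for w
  proof (rule ccontr)
    assume "w \<notin> set xs"
    then have "path (w # xs)" using xs that xs_eq
      by (auto simp: path_def nth_Cons insert_commute split: nat.splits)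
    then show False using max by fastforce
  qed
  have "x \<in> R" using xs by (auto simp: path_def xs_eq)
  \<comment> \<open>Avoiding the second vertex of the path puts \<open>w\<close> at position at
    least 2, so the cycle has at least three vertices. For a path with a single vertex, avoiding
    \<open>x\<close> already contradicts \<open>closed\<close>.\<close>
  then obtain w where w: "w \<in> R" "{x, w} \<in> E" "w \<noteq> (if ys = [] then x else hd ys)"
    using other by blast
  then obtain j where j: "j < length xs" "xs ! j = w"
    using closed by (metis in_set_conv_nth)
  have "j \<noteq> 0" using j w loop[of x] by (cases j) (auto simp: xs_eq)
  moreover have "j \<noteq> 1" using j w by (cases ys) (auto simp: xs_eq)
  ultimately have j2: "2 \<le> j" by simp
  have len: "length (take (Suc j) xs) = Suc j" and x0: "xs ! 0 = x"
    using j by (simp_all add: xs_eq)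
  have "is_cycle E (take (Suc j) xs)"
    unfolding is_cycle_def
  proof (intro conjI allI impI)
    show "3 \<le> length (take (Suc j) xs)" using j j2 by simp
    show "distinct (take (Suc j) xs)" using xs by (simp add: path_def)
    fix i assume "i < length (take (Suc j) xs)"
    then have i: "i \<le> j" using j by simp
    show "{take (Suc j) xs ! i, take (Suc j) xs ! (Suc i mod length (take (Suc j) xs))} \<in> E"
    proof (cases "i = j")
      case True
      then show ?thesis using j w by (simp add: len x0 insert_commute)
    next
      case False
      then show ?thesis using i j xs by (simp add: len path_def)
    qed
  qed
  then show False using nocyc by blast
qed

section \<open>Greedy defining sets as covers\<close>

definition precedes :: "'a list \<Rightarrow> 'a \<Rightarrow> 'a \<Rightarrow> bool" where
  "precedes \<sigma> u v \<longleftrightarrow> (\<exists>i j. i < j \<and> j < length \<sigma> \<and> \<sigma> ! i = u \<and> \<sigma> ! j = v)"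

text \<open>No neighbor of such a vertex is colored earlier by the greedy rule, so only a fixed
  neighbor can keep color 1 from it. These vertices form the set \<open>B\<close> of the covering
  problem.\<close>

definition local_minima :: "'a set set \<Rightarrow> 'a list \<Rightarrow> 'a set" where
  "local_minima E \<sigma> = {v. \<forall>u. {v, u} \<in> E \<longrightarrow> \<not> precedes \<sigma> u v}"

lemma precedes_append:
  assumes "distinct (xs @ v # ys)"
  shows "precedes (xs @ v # ys) u v \<longleftrightarrow> u \<in> set xs"
proof
  assume "precedes (xs @ v # ys) u v"
  then obtain i j where ij: "i < j" "j < length (xs @ v # ys)"
    "(xs @ v # ys) ! i = u" "(xs @ v # ys) ! j = v"
    by (auto simp: precedes_def)
  have "(xs @ v # ys) ! length xs = v" by simp
  then have "j = length xs"
    using ij assms nth_eq_iff_index_eq[OF assms, of j "length xs"] by simp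
  then show "u \<in> set xs" using ij by (auto simp: nth_append)
next
  assume "u \<in> set xs"
  then obtain i where "i < length xs" "xs ! i = u" by (auto simp: in_set_conv_nth)
  then show "precedes (xs @ v # ys) u v"
    unfolding precedes_def by (intro exI[of _ i] exI[of _ "length xs"]) (simp add: nth_append)
qed

lemma fold_color_vertex_other:
  "w \<notin> set xs \<Longrightarrow> fold (color_vertex E) xs c w = c w"
  by (induction xs arbitrary: c) (auto simp: color_vertex_def)

lemma greedy_coloring_fixed: "v \<in> dom p \<Longrightarrow> greedy_coloring E \<sigma> p v = p v"
  unfolding greedy_coloring_def by (rule fold_color_vertex_other) simp

text \<open>A colored vertex keeps its color, and when \<open>v\<close> is processed exactly the
  fixed and the preceding vertices are colored. The intermediate map can thus be replaced by the
  final coloring, which gives an equation without reference to the process.\<close>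

lemma greedy_coloring_unfixed:
  assumes "distinct \<sigma>" "v \<in> set \<sigma>" "v \<notin> dom p"
  shows "greedy_coloring E \<sigma> p v = Some (LEAST k. 0 < k \<and>
    (\<forall>u. {u, v} \<in> E \<and> (u \<in> dom p \<or> precedes \<sigma> u v) \<longrightarrow> greedy_coloring E \<sigma> p u \<noteq> Some k))"
proof -
  obtain xs ys where \<sigma>: "\<sigma> = xs @ v # ys" using assms(2) by (auto simp: in_set_conv_decomp)
  define cur where "cur = fold (color_vertex E) (filter (\<lambda>v. v \<notin> dom p) xs) p"
  have full: "greedy_coloring E \<sigma> p =
      fold (color_vertex E) (filter (\<lambda>v. v \<notin> dom p) ys) (color_vertex E v cur)"
    using assms(3) by (simp add: greedy_coloring_def \<sigma> cur_def)
  have other: "greedy_coloring E \<sigma> p u = cur u" if "u \<in> dom p \<or> u \<in> set xs" for u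
  proof -
    have "u \<noteq> v" using that assms \<sigma> by auto
    then show ?thesis unfolding full
      using that assms(1) \<sigma> by (subst fold_color_vertex_other) (auto simp: color_vertex_def)
  qed
  have none: "cur u = None" if "u \<notin> dom p" "u \<notin> set xs" for u
    using that unfolding cur_def by (subst fold_color_vertex_other) auto
  have "greedy_coloring E \<sigma> p v = color_vertex E v cur v"
    unfolding full using assms(1) \<sigma> by (intro fold_color_vertex_other) simp
  also have "\<dots> = Some (LEAST k. 0 < k \<and> (\<forall>u. {u, v} \<in> E \<longrightarrow> cur u \<noteq> Some k))"
    by (simp add: color_vertex_def)
  also have "(\<lambda>k. 0 < k \<and> (\<forall>u. {u, v} \<in> E \<longrightarrow> cur u \<noteq> Some k)) =
    (\<lambda>k. 0 < k \<and> (\<forall>u. {u, v} \<in> E \<and> (u \<in> dom p \<or> precedes \<sigma> u v) \<longrightarrow>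
       greedy_coloring E \<sigma> p u \<noteq> Some k))"
    using other none precedes_append[of xs v ys] assms(1) unfolding \<sigma>
    by (intro ext) (metis option.distinct(1))
  finally show ?thesis .
qed

lemma chromatic_number_le:
  "proper_coloring V E c \<Longrightarrow> chromatic_number V E \<le> card (c ` V)"
  unfolding chromatic_number_def by (rule Least_le) auto

text \<open>The fixed set itself is the cover. First fit denied the smaller color to an unfixed
  vertex of the larger one, so some neighbor colored before it has the smaller color; for a local
  minimum this neighbor must be fixed. The map \<open>d\<close> only serves to bound the number of
  colors by two.\<close>

lemma solvable_of_greedy_defining_set:
  fixes d :: "'a \<Rightarrow> bool"
  assumes gds: "greedy_defining_set V E \<sigma> p" and fin: "finite V"
    and \<sigma>: "\<sigma> \<in> permutations_of_set V"
    and two: "\<And>x y. x \<in> V \<Longrightarrow> y \<in> V \<Longrightarrow> {x, y} \<in> E \<Longrightarrow> d x \<noteq> d y"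
  shows "solvable E (local_minima E \<sigma>) V {} (\<lambda>_. 0) (\<lambda>_. 0) (card (dom p))"
proof -
  define c where "c v = the (greedy_coloring E \<sigma> p v)" for v
  define m where "m = Min (c ` V)"
  have p: "dom p \<subseteq> V" and c: "proper_coloring V E c" and card: "card (c ` V) = chromatic_number V E"
    using gds by (simp_all add: greedy_defining_set_def c_def[abs_def] Let_def)
  have "proper_coloring V E (\<lambda>v. if d v then 2 else 1)"
    using two by (fastforce simp: proper_coloring_def)
  then have "chromatic_number V E \<le> card ((\<lambda>v. if d v then 2 else 1 :: nat) ` V)"
    by (rule chromatic_number_le)
  also have "\<dots> \<le> card {1, 2 :: nat}" by (intro card_mono) auto
  finally have card2: "card (c ` V) \<le> 2" using card by simp
  have m: "m \<in> c ` V" "\<And>x. x \<in> V \<Longrightarrow> m \<le> c x" if "V \<noteq> {}"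
    using that fin by (simp_all add: m_def)
  \<comment> \<open>The two colors need not be 1 and 2, so the smaller one plays the role of color 1.\<close>
  show ?thesis
  proof (rule solvableI)
    show "dom p \<subseteq> V" by (rule p)
    show "(c x \<noteq> m) \<noteq> (c y \<noteq> m)" if xy: "x \<in> V" "y \<in> V" "{x, y} \<in> E" for x y
    proof
      assume eq: "(c x \<noteq> m) = (c y \<noteq> m)"
      have ne: "c x \<noteq> c y" using c xy by (simp add: proper_coloring_def)
      \<comment> \<open>Two different colors that both differ from \<open>m\<close> would make
        three.\<close>
      have "{m, c x, c y} \<subseteq> c ` V" using m xy by auto
      then have "card {m, c x, c y} \<le> card (c ` V)" using fin by (intro card_mono) auto
      then show False using eq ne card2 by (auto simp: card_insert_if split: if_splits)
    qed
    show "x \<in> dom p \<or> (\<exists>y\<in>dom p \<union> {}. {x, y} \<in> E)"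
      if x: "x \<in> V" "x \<in> local_minima E \<sigma>" "c x \<noteq> m" for x
    proof (cases "x \<in> dom p")
      case False
      define free where "free k \<longleftrightarrow> 0 < k \<and> (\<forall>u. {u, x} \<in> E \<and> (u \<in> dom p \<or> precedes \<sigma> u x)
          \<longrightarrow> greedy_coloring E \<sigma> p u \<noteq> Some k)" for k
      have "c x = (LEAST k. free k)"
        using \<sigma> x False greedy_coloring_unfixed[of \<sigma> x p E]
        by (simp add: c_def free_def permutations_of_set_def)
      moreover have ne: "V \<noteq> {}" using x(1) by auto
      then have "m < c x" using m(2)[OF _ x(1)] x(3) by linarith
      ultimately have "\<not> free m" using not_less_Least[of m free] by simp
      moreover have "0 < m" using m(1)[OF ne] c by (auto simp: proper_coloring_def)
      ultimately show ?thesis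
        using x(2) by (auto simp: free_def local_minima_def insert_commute)
    qed simp
  qed simp
qed

text \<open>Fixing the cover with the colors of \<open>d\<close> makes first fit reproduce
  \<open>d\<close>, by induction along the order: colored neighbors always have the other color, and
  an unfixed vertex of color 2 sees color 1 on a fixed neighbor or, if it is no local minimum, on an
  earlier one.\<close>

lemma greedy_defining_set_of_solvable:
  assumes solv: "solvable E (local_minima E \<sigma>) V {} (\<lambda>_. 0) (\<lambda>_. 0) k"
    and graph: "simple_graph V E" and \<sigma>: "\<sigma> \<in> permutations_of_set V"
  shows "\<exists>p. greedy_defining_set V E \<sigma> p \<and> card (dom p) \<le> k"
proof -
  have fin: "finite V" using graph by (simp add: simple_graph_def)
  \<comment> \<open>Without edges only one color may be used, although \<open>solvable\<close> allows both.\<close>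
  obtain d S where S: "S \<subseteq> V" "card S \<le> k"
    and two: "\<And>x y. x \<in> V \<Longrightarrow> y \<in> V \<Longrightarrow> {x, y} \<in> E \<Longrightarrow> d x \<noteq> d y"
    and cover: "\<And>x. x \<in> V \<Longrightarrow> x \<in> local_minima E \<sigma> \<Longrightarrow> d x \<Longrightarrow> x \<in> S \<or> (\<exists>y\<in>S. {x, y} \<in> E)"
    and triv: "E = {} \<Longrightarrow> \<forall>x. \<not> d x"
  proof (cases "E = {}")
    case True
    then show ?thesis by (intro that[of "{}" "\<lambda>_. False"]) auto
  next
    case False
    from solv obtain d S where "S \<subseteq> V"
      and "\<And>x y. x \<in> V \<Longrightarrow> y \<in> V \<Longrightarrow> {x, y} \<in> E \<Longrightarrow> d x \<noteq> d y"
      and "\<And>x. x \<in> V \<Longrightarrow> x \<in> local_minima E \<sigma> \<Longrightarrow> d x \<Longrightarrow> x \<in> S \<or> (\<exists>y\<in>S \<union> {}. {x, y} \<in> E)"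
      and "card S + (\<Sum>x\<in>V. if d x then 0 else 0) \<le> k"
      by (rule solvableE) blast
    with False show ?thesis by (intro that[of S d]) simp_all
  qed
  define col where "col v = (if d v then 2 else 1 :: nat)" for v
  define p where "p v = (if v \<in> S then Some (col v) else None)" for v
  have dom_p: "dom p = S" by (auto simp: p_def split: if_splits)
  have dist: "distinct \<sigma>" and set: "set \<sigma> = V" using \<sigma> by (simp_all add: permutations_of_set_def)
  have "greedy_coloring E \<sigma> p (\<sigma> ! i) = Some (col (\<sigma> ! i))" if "i < length \<sigma>" for i
    using that
  proof (induction i rule: less_induct)
    case (less i)
    define v where "v = \<sigma> ! i"
    have v: "v \<in> V" using less.prems set by (auto simp: v_def)
    show ?case
    proof (cases "v \<in> S")
      case True
      then have "greedy_coloring E \<sigma> p v = p v" using dom_p by (intro greedy_coloring_fixed) simp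
      then show ?thesis using True p_def[of v] by (simp add: v_def)
    next
      case False
      define colored where "colored u \<longleftrightarrow> {u, v} \<in> E \<and> (u \<in> dom p \<or> precedes \<sigma> u v)" for u
      have colored: "greedy_coloring E \<sigma> p u = Some (col u)" "d u \<noteq> d v" if u: "colored u" for u
      proof -
        have "greedy_coloring E \<sigma> p u = Some (col u) \<and> u \<in> V"
        proof (cases "u \<in> S")
          case True
          then have "greedy_coloring E \<sigma> p u = p u"
            using dom_p by (intro greedy_coloring_fixed) simp
          then show ?thesis using True S p_def[of u] by auto
        next
          case False
          then obtain j l where j: "j < l" "l < length \<sigma>" "\<sigma> ! j = u" "\<sigma> ! l = \<sigma> ! i"
            using u by (auto simp: colored_def dom_p precedes_def v_def)
          then have "l = i" using dist less.prems by (simp add: nth_eq_iff_index_eq)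
          then show ?thesis using j less.IH[of j] set nth_mem[of j \<sigma>] by simp
        qed
        then show "greedy_coloring E \<sigma> p u = Some (col u)" and "d u \<noteq> d v"
          using two[of u v] v u by (simp_all add: colored_def)
      qed
      have "(LEAST k. 0 < k \<and> (\<forall>u. colored u \<longrightarrow> greedy_coloring E \<sigma> p u \<noteq> Some k)) = col v"
      proof (rule Least_equality)
        show "0 < col v \<and> (\<forall>u. colored u \<longrightarrow> greedy_coloring E \<sigma> p u \<noteq> Some (col v))"
          using colored by (auto simp: col_def)
      next
        fix k assume k: "0 < k \<and> (\<forall>u. colored u \<longrightarrow> greedy_coloring E \<sigma> p u \<noteq> Some k)"
        show "col v \<le> k"
        proof (cases "d v")
          case True
          then have "\<exists>u. colored u"
            using cover[OF v] \<open>v \<notin> S\<close>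
            by (auto simp: colored_def dom_p local_minima_def insert_commute)
          then have "k \<noteq> 1" using k colored True by (auto simp: col_def)
          then show ?thesis using k by (simp add: col_def)
        qed (use k in \<open>simp add: col_def\<close>)
      qed
      moreover have "greedy_coloring E \<sigma> p v = Some (LEAST k. 0 < k \<and>
          (\<forall>u. colored u \<longrightarrow> greedy_coloring E \<sigma> p u \<noteq> Some k))"
        unfolding colored_def using False v dist set dom_p by (intro greedy_coloring_unfixed) auto
      ultimately show ?thesis by (simp add: v_def)
    qed
  qed
  then have greedy: "the (greedy_coloring E \<sigma> p v) = col v" if "v \<in> V" for v
    using that set by (metis in_set_conv_nth option.sel)
  define c where "c v = the (greedy_coloring E \<sigma> p v)" for v
  have img: "c ` V = col ` V" using greedy by (simp add: c_def)
  have proper: "proper_coloring V E c"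
    using two greedy by (fastforce simp: proper_coloring_def c_def col_def)
  \<comment> \<open>The coloring is optimal: an edge forces two colors in every proper coloring, and
    without edges \<open>triv\<close> leaves at most one color in use.\<close>
  have "card (c ` V) \<le> card (e ` V)" if e: "proper_coloring V E e" for e
  proof (cases "E = {}")
    case True
    then have "c ` V = (\<lambda>_. 1) ` V" using triv by (simp add: img col_def)
    then have "card (c ` V) \<le> (if V = {} then 0 else 1)" by (simp add: image_constant_conv)
    also have "\<dots> \<le> card (e ` V)" using fin by (simp add: Suc_leI card_gt_0_iff)
    finally show ?thesis .
  next
    case False
    then obtain ed where ed: "ed \<in> E" by auto
    have "\<forall>e\<in>E. \<exists>u\<in>V. \<exists>v\<in>V. u \<noteq> v \<and> e = {u, v}"
      using graph by (simp add: simple_graph_def)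
    from bspec[OF this ed] obtain u v where uv: "u \<in> V" "v \<in> V" "{u, v} \<in> E"
      using ed by auto
    have "card (c ` V) \<le> card {1, 2 :: nat}" unfolding img by (intro card_mono) (auto simp: col_def)
    also have "\<dots> = card {e u, e v}" using e uv by (simp add: proper_coloring_def)
    also have "\<dots> \<le> card (e ` V)" using fin uv by (intro card_mono) auto
    finally show ?thesis .
  qed
  then have "chromatic_number V E = card (c ` V)"
    unfolding chromatic_number_def using proper by (intro Least_equality) auto
  then have "greedy_defining_set V E \<sigma> p"
    using proper S dom_p unfolding greedy_defining_set_def c_def[abs_def] Let_def
    by (auto simp: p_def ran_def col_def)
  then show ?thesis using S dom_p by auto
qed

text \<open>With zero costs and no marks, only the size of the cover is counted. The threshold form
  of the assumption is what the invariant of the algorithm delivers at its end.\<close>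

lemma GDN_eqI:
  fixes V :: "'a set"
  assumes graph: "simple_graph V E" and \<sigma>: "\<sigma> \<in> permutations_of_set V"
    and t: "\<And>k. solvable E (local_minima E \<sigma>) V {} (\<lambda>_. 0) (\<lambda>_. 0) k \<longleftrightarrow> t \<le> k"
  shows "GDN V E \<sigma> = t"
proof -
  have fin: "finite V" using graph by (simp add: simple_graph_def)
  \<comment> \<open>The 2-coloring for the lower bound is taken from a solution at \<open>t\<close>,
    not from acyclicity.\<close>
  have "solvable E (local_minima E \<sigma>) V {} (\<lambda>_. 0) (\<lambda>_. 0) t" by (simp add: t)
  then obtain d :: "'a \<Rightarrow> bool" where "\<And>x y. x \<in> V \<Longrightarrow> y \<in> V \<Longrightarrow> {x, y} \<in> E \<Longrightarrow> d x \<noteq> d y"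
    by (rule solvableE) blast
  then have lower: "t \<le> card (dom p)" if "greedy_defining_set V E \<sigma> p" for p
    using solvable_of_greedy_defining_set[OF that fin \<sigma>] t by blast
  obtain p where "greedy_defining_set V E \<sigma> p" "card (dom p) \<le> t"
    using greedy_defining_set_of_solvable[OF _ graph \<sigma>, of t] t by auto
  then show ?thesis
    unfolding GDN_def using lower by (intro Least_equality) (auto intro: le_antisym)
qed

section \<open>Running time of programs\<close>

text \<open>A total-correctness judgement with a time budget. An upper bound in place of the exact
  time lets branches of different length share one budget.\<close>

definition runs :: "com \<Rightarrow> memory \<Rightarrow> nat \<Rightarrow> (memory \<Rightarrow> bool) \<Rightarrow> bool" where
  "runs c s T Q \<longleftrightarrow> (\<exists>t s'. exec c s t s' \<and> t \<le> T \<and> Q s')"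

lemma runs_mono:
  "runs c s T Q \<Longrightarrow> T \<le> T' \<Longrightarrow> (\<And>s'. Q s' \<Longrightarrow> Q' s') \<Longrightarrow> runs c s T' Q'"
  unfolding runs_def by (meson order_trans)

lemma runs_Seq:
  "runs c1 s T1 (\<lambda>s'. runs c2 s' T2 Q) \<Longrightarrow> runs (Seq c1 c2) s (T1 + T2) Q"
  unfolding runs_def by (meson add_mono exec.Seq)

lemma runs_Cond:
  assumes "eval_expr e s \<noteq> 0 \<Longrightarrow> runs c1 s T Q" "eval_expr e s = 0 \<Longrightarrow> runs c2 s T Q"
  shows "runs (Cond e c1 c2) s (1 + T) Q"
proof (cases "eval_expr e s = 0")
  case True
  then show ?thesis using assms(2) unfolding runs_def by (meson CondFalse add_left_mono)
next
  case False
  then show ?thesis using assms(1) unfolding runs_def by (meson CondTrue add_left_mono)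
qed

fun loop_free :: "com \<Rightarrow> bool" where
  "loop_free (Seq c1 c2) \<longleftrightarrow> loop_free c1 \<and> loop_free c2"
| "loop_free (Cond e c1 c2) \<longleftrightarrow> loop_free c1 \<and> loop_free c2"
| "loop_free (While e c) \<longleftrightarrow> False"
| "loop_free c \<longleftrightarrow> True"

text \<open>A symbolic evaluator for code without loops. The last equation is meant for
  \<open>Skip\<close>; for \<open>While\<close> it is a dummy value, excluded by
  \<open>loop_free\<close>.\<close>

fun result :: "com \<Rightarrow> memory \<Rightarrow> memory" where
  "result (Assign a i e) s = s(a := (s a)(eval_expr i s := eval_expr e s))"
| "result (Seq c1 c2) s = result c2 (result c1 s)"
| "result (Cond e c1 c2) s = (if eval_expr e s \<noteq> 0 then result c1 s else result c2 s)"
| "result c s = s"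

fun max_time :: "com \<Rightarrow> nat" where
  "max_time (Seq c1 c2) = max_time c1 + max_time c2"
| "max_time (Cond e c1 c2) = 1 + max (max_time c1) (max_time c2)"
| "max_time c = 1"

lemma runs_loop_free:
  "loop_free c \<Longrightarrow> Q (result c s) \<Longrightarrow> runs c s (max_time c) Q"
proof (induction c arbitrary: s Q)
  case (Cond e c1 c2)
  show ?case unfolding max_time.simps
    using Cond by (intro runs_Cond; intro runs_mono[OF Cond.IH(1)] runs_mono[OF Cond.IH(2)]) auto
next
  case (Seq c1 c2)
  then show ?case by (auto intro: runs_Seq)
next
  case (Assign a i e)
  then show ?case unfolding runs_def result.simps max_time.simps
    using exec.Assign[of a i e s] by (meson order_refl)
next
  case Skip
  then show ?case unfolding runs_def result.simps max_time.simps
    using exec.Skip[of s] by (meson order_refl)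
qed simp

abbreviation scalar :: "nat \<Rightarrow> expr" where "scalar a \<equiv> Cell a (Const 0)"

abbreviation set_scalar :: "nat \<Rightarrow> expr \<Rightarrow> com" where "set_scalar a \<equiv> Assign a (Const 0)"

text \<open>The bound of every loop is the number of vertices, cell 0 of the input array.\<close>

definition for_loop :: "nat \<Rightarrow> com \<Rightarrow> com" where
  "for_loop i body = Seq (set_scalar i (Const 0))
     (While (Minus (scalar 0) (scalar i)) (Seq body (set_scalar i (Plus (scalar i) (Const 1)))))"

text \<open>The invariant is asserted when the counter has just been set, hence the updated memories
  in the assumptions. Each iteration adds a test and an increment to the body; initialization and
  the failing test account for the final 2.\<close>

lemma runs_for_loop:
  assumes init: "I 0 (s(i := (s i)(0 := 0)))" and "i \<noteq> 0"
    and bound: "\<And>k s. I k s \<Longrightarrow> s 0 0 = n"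
    and step: "\<And>k s. k < n \<Longrightarrow> I k s \<Longrightarrow> s i 0 = k \<Longrightarrow>
      runs body s T (\<lambda>s'. s' i 0 = k \<and> I (Suc k) (s'(i := (s' i)(0 := Suc k))))"
    and final: "\<And>s. I n s \<Longrightarrow> Q s"
  shows "runs (for_loop i body) s (n * (T + 2) + 2) Q"
proof -
  let ?e = "Minus (scalar 0) (scalar i)"
  let ?c = "Seq body (set_scalar i (Plus (scalar i) (Const 1)))"
  have loop: "runs (While ?e ?c) s ((n - k) * (T + 2) + 1) Q"
    if "k \<le> n" "I k s" "s i 0 = k" for k s
    using that
  proof (induction "n - k" arbitrary: k s)
    case 0
    then have "exec (While ?e ?c) s 1 s" by (intro WhileFalse) (simp add: bound)
    then show ?case using 0 final[of s] unfolding runs_def by auto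
  next
    case (Suc m)
    then have k: "k < n" by simp
    obtain t1 s1 where 1: "exec body s t1 s1" "t1 \<le> T" "s1 i 0 = k"
      "I (Suc k) (s1(i := (s1 i)(0 := Suc k)))"
      using step[OF k Suc.prems(2,3)] unfolding runs_def by auto
    let ?s2 = "s1(i := (s1 i)(0 := Suc k))"
    have "exec (set_scalar i (Plus (scalar i) (Const 1))) s1 1 ?s2"
      using exec.Assign[of i "Const 0" "Plus (scalar i) (Const 1)" s1] 1 by simp
    then have body: "exec ?c s (t1 + 1) ?s2" using 1 by (intro exec.Seq)
    have "runs (While ?e ?c) ?s2 ((n - Suc k) * (T + 2) + 1) Q"
      using Suc.hyps k 1 by (intro Suc.hyps(1)) auto
    then obtain t2 s3 where 2: "exec (While ?e ?c) ?s2 t2 s3"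
      "t2 \<le> (n - Suc k) * (T + 2) + 1" "Q s3"
      unfolding runs_def by auto
    have "exec (While ?e ?c) s (1 + (t1 + 1) + t2) s3"
      using k Suc.prems bound[OF Suc.prems(2)] by (intro WhileTrue[OF _ body 2(1)]) simp
    moreover have "n - k = Suc (n - Suc k)" using k by simp
    then have "1 + (t1 + 1) + t2 \<le> (n - k) * (T + 2) + 1" using 1 2 by simp
    ultimately show ?case using 2 unfolding runs_def by blast
  qed
  have "exec (set_scalar i (Const 0)) s 1 (s(i := (s i)(0 := 0)))"
    using exec.Assign[of i "Const 0" "Const 0" s] by simp
  then have "runs (set_scalar i (Const 0)) s 1
      (\<lambda>s'. runs (While ?e ?c) s' (n * (T + 2) + 1) Q)"
    unfolding runs_def[of "set_scalar i (Const 0)"]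
    using loop[of 0 "s(i := (s i)(0 := 0))"] init by auto
  from runs_Seq[OF this] show ?thesis unfolding for_loop_def by (rule runs_mono) auto
qed

section \<open>The algorithm\<close>

abbreviation (input) "OUTPUT \<equiv> 1 :: nat"
abbreviation (input) "POS \<equiv> 2 :: nat"
abbreviation (input) "ROW \<equiv> 3 :: nat"
abbreviation (input) "REMOVED \<equiv> 4 :: nat"
abbreviation (input) "MARKED \<equiv> 5 :: nat"
abbreviation (input) "COST2 \<equiv> 6 :: nat"
abbreviation (input) "COST1 \<equiv> 7 :: nat"
abbreviation (input) "ROUND \<equiv> 8 :: nat"
abbreviation (input) "VERTEX \<equiv> 9 :: nat"
abbreviation (input) "NEIGHBOR \<equiv> 10 :: nat"
abbreviation (input) "DEGREE \<equiv> 11 :: nat"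
abbreviation (input) "PARENT \<equiv> 12 :: nat"
abbreviation (input) "BLOCKED \<equiv> 13 :: nat"
abbreviation (input) "OFFSET \<equiv> 14 :: nat"

text \<open>The machine cannot multiply, so the start addresses of the matrix rows are accumulated
  by repeated addition. The same pass inverts the permutation that lists the vertices.\<close>

definition setup_body :: com where
  "setup_body =
     Seq (Assign POS (Cell 0 (Plus (scalar ROUND) (Const 1))) (scalar ROUND))
    (Seq (Assign ROW (scalar ROUND) (scalar OFFSET))
         (set_scalar OFFSET (Plus (scalar OFFSET) (scalar 0))))"

text \<open>Only remaining neighbors count for the degree, but removed ones also block: a marked or
  earlier neighbor spares the vertex its cover even after removal. The parent is the last remaining
  neighbor found, so it is unique when the degree is 1.\<close>

definition scan_body :: com where
  "scan_body = Cond (Cell 0 (Plus (Cell ROW (scalar VERTEX)) (scalar NEIGHBOR)))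
     (Seq (Cond (Cell REMOVED (scalar NEIGHBOR)) Skip
            (Seq (set_scalar DEGREE (Plus (scalar DEGREE) (Const 1)))
                 (set_scalar PARENT (scalar NEIGHBOR))))
     (Seq (Cond (Cell MARKED (scalar NEIGHBOR)) (set_scalar BLOCKED (Const 1)) Skip)
          (Cond (Minus (Cell POS (scalar VERTEX)) (Cell POS (scalar NEIGHBOR)))
             (set_scalar BLOCKED (Const 1)) Skip)))
     Skip"

definition scan :: com where
  "scan = Seq (Seq (set_scalar DEGREE (Const 0)) (set_scalar BLOCKED (Const 0)))
     (for_loop NEIGHBOR scan_body)"

text \<open>A vertex that has two remaining neighbors is left alone. The last assignment adds a minimum,
  written as \<open>x - (x - y)\<close>.\<close>

definition remove :: com where
  "remove = Cond (Minus (scalar DEGREE) (Const 1)) Skip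
     (Seq (Assign REMOVED (scalar VERTEX) (Const 1))
     (Seq (Cond (scalar BLOCKED) Skip
            (Assign COST2 (scalar VERTEX) (Plus (Cell COST2 (scalar VERTEX)) (Const 1))))
       (Cond (scalar DEGREE)
         (Seq (Cond (scalar BLOCKED) Skip (Assign MARKED (scalar PARENT) (Const 1)))
         (Seq (Assign COST2 (scalar PARENT)
                 (Plus (Cell COST2 (scalar PARENT)) (Cell COST1 (scalar VERTEX))))
              (Assign COST1 (scalar PARENT)
                 (Plus (Cell COST1 (scalar PARENT)) (Cell COST2 (scalar VERTEX))))))
         (set_scalar OUTPUT (Plus (scalar OUTPUT) (Minus (Cell COST2 (scalar VERTEX))
            (Minus (Cell COST2 (scalar VERTEX)) (Cell COST1 (scalar VERTEX)))))))))"

definition visit :: com where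
  "visit = Cond (Cell REMOVED (scalar VERTEX)) Skip (Seq scan remove)"

text \<open>As many rounds as vertices suffice, since each round removes a vertex while any are
  left. The offset starts behind the vertex count and the order.\<close>

definition gdn_program :: com where
  "gdn_program = Seq (set_scalar OFFSET (Plus (scalar 0) (Const 1)))
     (Seq (for_loop ROUND setup_body) (for_loop ROUND (for_loop VERTEX visit)))"

section \<open>Row-by-row layout of the adjacency matrix\<close>

lemma length_concat_map_const:
  "(\<And>u. u < m \<Longrightarrow> length (f u) = k) \<Longrightarrow> length (concat (map f [0..<m])) = m * k"
  by (induction m) auto

lemma nth_concat_map_const:
  assumes "\<And>u. u < m \<Longrightarrow> length (f u) = k" "u < m" "v < k"
  shows "concat (map f [0..<m]) ! (u * k + v) = f u ! v"
  using assms
proof (induction m)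
  case (Suc m)
  have len: "length (concat (map f [0..<m])) = m * k"
    using Suc.prems by (intro length_concat_map_const) simp
  show ?case
  proof (cases "u = m")
    case True
    then show ?thesis using len by (simp add: nth_append)
  next
    case False
    then have "u < m" using Suc.prems by simp
    have "u * k + v < Suc u * k" using Suc.prems by simp
    also have "\<dots> \<le> m * k" using \<open>u < m\<close> by (intro mult_le_mono) auto
    finally show ?thesis using Suc \<open>u < m\<close> len by (simp add: nth_append)
  qed
qed simp

section \<open>Correctness and cost of the program on a fixed ordered forest\<close>

locale ordered_forest =
  fixes n :: nat and E :: "nat set set" and \<sigma> :: "nat list"
  assumes forest: "forest {..<n} E" and \<sigma>: "\<sigma> \<in> permutations_of_set {..<n}"
begin

lemma edge_less: "{u, v} \<in> E \<Longrightarrow> u < n \<and> v < n"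
  using forest unfolding forest_def simple_graph_def
  by (metis insertI1 insert_commute lessThan_iff doubleton_eq_iff)

definition alive :: "memory \<Rightarrow> nat set" where
  "alive s = {w. w < n \<and> s REMOVED w = 0}"

definition marked :: "memory \<Rightarrow> nat set" where
  "marked s = {w. w < n \<and> s MARKED w \<noteq> 0}"

definition ready :: "memory \<Rightarrow> bool" where
  "ready s \<longleftrightarrow> s 0 0 = n \<and>
     (\<forall>u<n. \<forall>v<n. s 0 (s ROW u + v) = of_bool ({u, v} \<in> E)) \<and>
     (\<forall>u<n. \<forall>v<n. s POS u < s POS v \<longleftrightarrow> precedes \<sigma> u v)"

text \<open>Invariant of the neighbor scan after \<open>k\<close> candidates. At
  \<open>k = n\<close>, a zero in \<open>BLOCKED\<close> is the condition \<open>pick\<close> of the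
  removal lemmas.\<close>

definition scanned :: "nat \<Rightarrow> nat \<Rightarrow> memory \<Rightarrow> bool" where
  "scanned v k s \<longleftrightarrow> s DEGREE 0 = card {w \<in> alive s. w < k \<and> {v, w} \<in> E} \<and>
     (s DEGREE 0 \<noteq> 0 \<longrightarrow> s PARENT 0 \<in> alive s \<and> {v, s PARENT 0} \<in> E) \<and>
     (s BLOCKED 0 \<noteq> 0 \<longleftrightarrow> (\<exists>w<k. {v, w} \<in> E \<and> (w \<in> marked s \<or> precedes \<sigma> w v)))"

lemma scanned_counter: "scanned v k (s(NEIGHBOR := f)) \<longleftrightarrow> scanned v k s"
  by (simp add: scanned_def alive_def marked_def)

abbreviation preserved :: "memory \<Rightarrow> memory \<Rightarrow> bool" where
  "preserved s0 s \<equiv> \<forall>a. a \<notin> {NEIGHBOR, DEGREE, PARENT, BLOCKED} \<longrightarrow> s a = s0 a"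

lemma runs_scan:
  assumes s0: "ready s0" "s0 VERTEX 0 = v" "v < n"
  shows "runs scan s0 (n * (max_time scan_body + 2) + 4)
    (\<lambda>s. preserved s0 s \<and> scanned v n s)"
proof -
  let ?init = "Seq (set_scalar DEGREE (Const 0)) (set_scalar BLOCKED (Const 0))"
  let ?I = "\<lambda>k s. preserved s0 s \<and> scanned v k s"
  have "runs (for_loop NEIGHBOR scan_body) (result ?init s0) (n * (max_time scan_body + 2) + 2)
      (\<lambda>s. preserved s0 s \<and> scanned v n s)"
  proof (rule runs_for_loop[where I = ?I])
    show "?I 0 ((result ?init s0)(NEIGHBOR := (result ?init s0 NEIGHBOR)(0 := 0)))"
      by (simp add: scanned_def)
    show "s 0 0 = n" if "?I k s" for k s
      using that s0 by (simp add: ready_def)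
    fix k s assume k: "k < n" and I: "?I k s" and sk: "s NEIGHBOR 0 = k"
    define s' where "s' = result scan_body s"
    have eq: "s 0 = s0 0" "s ROW = s0 ROW" "s POS = s0 POS" "s VERTEX = s0 VERTEX"
      "s REMOVED = s0 REMOVED" "s MARKED = s0 MARKED"
      using I by auto
    have edge: "s 0 (s ROW v + k) = of_bool ({v, k} \<in> E)"
      and prec: "s POS k < s POS v \<longleftrightarrow> precedes \<sigma> k v"
      using s0 k by (simp_all add: ready_def eq)
    have deg: "{w \<in> alive s. w < Suc k \<and> {v, w} \<in> E} = (if {v, k} \<in> E \<and> s REMOVED k = 0
        then insert k {w \<in> alive s. w < k \<and> {v, w} \<in> E}
        else {w \<in> alive s. w < k \<and> {v, w} \<in> E})"
      using k by (auto simp: alive_def less_Suc_eq)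
    have fin: "finite {w \<in> alive s. w < k \<and> {v, w} \<in> E}" by simp
    have pres: "preserved s0 s'" and cnt: "s' NEIGHBOR 0 = k"
      using I sk by (simp_all add: s'_def scan_body_def)
    have same: "alive s' = alive s" "marked s' = marked s"
      by (simp_all add: s'_def scan_body_def alive_def marked_def)
    have "scanned v (Suc k) s'"
      using I edge prec fin k sk s0(2)
      unfolding scanned_def same deg
      by (auto simp: s'_def scan_body_def eq alive_def marked_def less_Suc_eq)
    then have "scanned v (Suc k) (s'(NEIGHBOR := (s' NEIGHBOR)(0 := Suc k)))"
      by (simp add: scanned_counter)
    then show "runs scan_body s (max_time scan_body)
        (\<lambda>s'. s' NEIGHBOR 0 = k \<and> ?I (Suc k) (s'(NEIGHBOR := (s' NEIGHBOR)(0 := Suc k))))"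
      using pres cnt by (intro runs_loop_free) (simp_all add: s'_def scan_body_def)
  qed simp_all
  then have "runs ?init s0 (max_time ?init) (\<lambda>s. runs (for_loop NEIGHBOR scan_body) s
      (n * (max_time scan_body + 2) + 2) (\<lambda>s. preserved s0 s \<and> scanned v n s))"
    by (intro runs_loop_free) simp_all
  from runs_Seq[OF this] show ?thesis
    unfolding scan_def by (rule runs_mono) simp_all
qed

abbreviation solvable_forest :: "nat set \<Rightarrow> nat set \<Rightarrow> (nat \<Rightarrow> nat) \<Rightarrow> (nat \<Rightarrow> nat) \<Rightarrow> nat \<Rightarrow> bool" where
  "solvable_forest \<equiv> solvable E (local_minima E \<sigma>)"

text \<open>The invariant of the main loop: the remaining problem, together with the output so far, has
  the same optimum as the original one.\<close>

definition correct :: "memory \<Rightarrow> bool" where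
  "correct s \<longleftrightarrow> ready s \<and>
     (\<forall>k. solvable_forest {..<n} {} (\<lambda>_. 0) (\<lambda>_. 0) k \<longleftrightarrow> s OUTPUT 0 \<le> k \<and>
        solvable_forest (alive s) (marked s) (s COST2) (s COST1) (k - s OUTPUT 0))"

lemma correct_counter: "i \<in> {ROUND, VERTEX} \<Longrightarrow> correct (s(i := f)) \<longleftrightarrow> correct s"
  by (auto simp: correct_def ready_def alive_def marked_def)

text \<open>For degree 0 and 1 the updates of the program are the primed marks and costs of the two
  removal lemmas; for larger degree nothing changes. The last claim supplies the progress argument
  of a round.\<close>

lemma remove_correct:
  assumes s: "correct s" and sv: "s VERTEX 0 = v" and v: "v \<in> alive s" and scan: "scanned v n s"
  defines "s' \<equiv> result remove s"
  shows "correct s'" and "s' ROUND = s ROUND" and "s' VERTEX = s VERTEX"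
    and "alive s' =
      (if card {w \<in> alive s. {v, w} \<in> E} \<le> 1 then alive s - {v} else alive s)"
proof -
  let ?R = "alive s" and ?M = "marked s"
  let ?nb = "{w \<in> ?R. {v, w} \<in> E}"
  define pick where "pick \<longleftrightarrow> s BLOCKED 0 = 0"
  have fin: "finite ?R" by (simp add: alive_def)
  have vn: "v < n" "s REMOVED v = 0" using v by (simp_all add: alive_def)
  have deg: "s DEGREE 0 = card ?nb"
    and par: "s DEGREE 0 \<noteq> 0 \<Longrightarrow> s PARENT 0 \<in> ?R \<and> {v, s PARENT 0} \<in> E"
    and pick: "pick \<longleftrightarrow> v \<in> local_minima E \<sigma> \<and> \<not> (\<exists>y\<in>?M. {v, y} \<in> E)"
  proof -
    have "{w \<in> ?R. w < n \<and> {v, w} \<in> E} = ?nb" by (auto simp: alive_def)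
    then show "s DEGREE 0 = card ?nb" using scan by (simp add: scanned_def)
    show "s PARENT 0 \<in> ?R \<and> {v, s PARENT 0} \<in> E" if "s DEGREE 0 \<noteq> 0"
      using scan that by (simp add: scanned_def)
    \<comment> \<open>All neighbors lie below \<open>n\<close>, so the bounded scan has seen every
      one of them.\<close>
    have "\<exists>w<n. P w \<and> {v, w} \<in> E" if "{v, w} \<in> E" "P w" for w P
      using that edge_less by auto
    then show "pick \<longleftrightarrow> v \<in> local_minima E \<sigma> \<and> \<not> (\<exists>y\<in>?M. {v, y} \<in> E)"
      using scan edge_less unfolding scanned_def pick_def local_minima_def by auto
  qed
  have unchanged: "s' 0 = s 0" "s' POS = s POS" "s' ROW = s ROW"
      "s' ROUND = s ROUND" "s' VERTEX = s VERTEX"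
    by (simp_all add: s'_def remove_def)
  show "s' ROUND = s ROUND" "s' VERTEX = s VERTEX" by (rule unchanged)+
  have alive': "alive s' = (if card ?nb \<le> 1 then ?R - {v} else ?R)"
    using deg sv by (auto simp: s'_def remove_def alive_def)
  show "alive s' = (if card ?nb \<le> 1 then ?R - {v} else ?R)" by (rule alive')
  have ready: "ready s'"
    using s unchanged by (simp add: correct_def ready_def)
  have orig: "solvable_forest {..<n} {} (\<lambda>_. 0) (\<lambda>_. 0) k \<longleftrightarrow> s OUTPUT 0 \<le> k \<and>
      solvable_forest ?R ?M (s COST2) (s COST1) (k - s OUTPUT 0)" for k
    using s by (simp add: correct_def)
  consider "card ?nb = 0" | "card ?nb = 1" | "2 \<le> card ?nb" by linarith
  then show "correct s'"
  proof cases
    case 1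
    then have nb: "?nb = {}" using fin by simp
    \<comment> \<open>The raised cost of color 2 is stored at \<open>v\<close> itself. As
      \<open>v\<close> leaves the remaining set, the new array can still serve as
      \<open>a'\<close>.\<close>
    have s'_arrays: "s' COST1 = s COST1" "marked s' = ?M"
        "s' OUTPUT 0 = s OUTPUT 0 + min (s COST2 v + of_bool pick) (s COST1 v)"
        "\<And>x. x \<noteq> v \<Longrightarrow> s' COST2 x = s COST2 x"
      using deg 1 sv by (auto simp: s'_def remove_def pick_def marked_def)
    have "solvable_forest ?R ?M (s COST2) (s COST1) k \<longleftrightarrow>
        min (s COST2 v + of_bool pick) (s COST1 v) \<le> k \<and>
        solvable_forest (alive s') (marked s') (s' COST2) (s' COST1)
          (k - min (s COST2 v + of_bool pick) (s COST1 v))" for k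
      using solvable_remove_isolated[OF fin v nb pick, of "s' COST2"] s'_arrays alive' 1 by simp
    then show ?thesis
      unfolding correct_def orig using ready s'_arrays(3) by auto
  next
    case 2
    define u where "u = s PARENT 0"
    have "u \<in> ?nb" using par deg 2 by (simp add: u_def)
    then have nb: "?nb = {u}" using 2 by (metis card_1_singletonE singletonD)
    have uv: "u \<noteq> v" using \<open>u \<in> ?nb\<close> forest_no_loop[OF forest, of v] by auto
    have un: "u < n" using \<open>u \<in> ?nb\<close> by (simp add: alive_def)
    \<comment> \<open>The surcharge reaches \<open>COST1\<close> at \<open>u\<close> because
      \<open>COST2\<close> at \<open>v\<close> is raised before it is added there.\<close>
    have s'_arrays: "s' OUTPUT = s OUTPUT" "marked s' = (if pick then insert u ?M else ?M)"
        "s' COST2 u = s COST2 u + s COST1 v"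
        "s' COST1 u = s COST1 u + (s COST2 v + of_bool pick)"
        "\<And>x. x \<noteq> v \<Longrightarrow> x \<noteq> u \<Longrightarrow> s' COST2 x = s COST2 x"
        "\<And>x. x \<noteq> u \<Longrightarrow> s' COST1 x = s COST1 x"
      using deg 2 sv uv un by (auto simp: s'_def remove_def pick_def marked_def u_def)
    have "solvable_forest ?R ?M (s COST2) (s COST1) k \<longleftrightarrow>
        solvable_forest (?R - {v}) (marked s') (s' COST2) (s' COST1) k" for k
      using forest_no_loop[OF forest] s'_arrays
      by (intro solvable_remove_leaf[OF fin v nb _ pick]) auto
    then show ?thesis
      unfolding correct_def orig using ready s'_arrays(1) alive' 2 by simp
  next
    case 3
    then have "s' = s" using deg by (simp add: s'_def remove_def)
    then show ?thesis using s by simp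
  qed
qed

lemma runs_visit:
  assumes s: "correct s" and v: "s VERTEX 0 = v" "v < n"
  shows "runs visit s (1 + (n * (max_time scan_body + 2) + 4 + max_time remove))
    (\<lambda>s'. correct s' \<and> s' ROUND = s ROUND \<and> s' VERTEX = s VERTEX \<and> alive s' \<subseteq> alive s \<and>
       (alive s' = alive s \<longrightarrow> v \<in> alive s \<longrightarrow> 2 \<le> card {w \<in> alive s. {v, w} \<in> E}))"
    (is "runs _ _ _ ?Q")
  unfolding visit_def
proof (rule runs_Cond)
  let ?T = "n * (max_time scan_body + 2) + 4"
  assume "eval_expr (Cell REMOVED (scalar VERTEX)) s = 0"
  then have va: "v \<in> alive s" using v by (simp add: alive_def)
  have "runs remove s1 (max_time remove) ?Q" if s1: "preserved s s1" "scanned v n s1" for s1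
  proof (rule runs_loop_free)
    have same: "alive s1 = alive s" "marked s1 = marked s" "s1 ROUND = s ROUND" "s1 VERTEX = s VERTEX"
      using s1 by (simp_all add: alive_def marked_def)
    have "correct s1" using s s1 unfolding correct_def same by (simp add: ready_def)
    note rc = remove_correct[OF this _ _ s1(2), unfolded same, OF v(1) va]
    show "?Q (result remove s1)" using rc va by (auto split: if_splits)
  qed (simp add: remove_def)
  then have "runs scan s ?T (\<lambda>s1. runs remove s1 (max_time remove) ?Q)"
    using s v by (intro runs_mono[OF runs_scan]) (auto simp: correct_def)
  then show "runs (Seq scan remove) s (?T + max_time remove) ?Q" by (rule runs_Seq)
next
  assume "eval_expr (Cell REMOVED (scalar VERTEX)) s \<noteq> 0"
  then have "v \<notin> alive s" using v by (simp add: alive_def)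
  then have "runs Skip s (max_time Skip) ?Q" using s by (intro runs_loop_free) auto
  then show "runs Skip s (n * (max_time scan_body + 2) + 4 + max_time remove) ?Q"
    by (rule runs_mono) auto
qed

text \<open>If a round removed nothing, every remaining vertex would have been seen with at least
  two remaining neighbors, contrary to \<open>forest_leaf\<close>. Truncated subtraction covers the
  case that no vertex remains.\<close>

lemma runs_round:
  assumes s: "correct s"
  shows "runs (for_loop VERTEX visit) s
      (n * (1 + (n * (max_time scan_body + 2) + 4 + max_time remove) + 2) + 2)
    (\<lambda>s'. correct s' \<and> s' ROUND = s ROUND \<and> card (alive s') \<le> card (alive s) - 1)"
proof (rule runs_for_loop[where I = "\<lambda>k s'. correct s' \<and> s' ROUND = s ROUND \<and>
    alive s' \<subseteq> alive s \<and> (alive s' = alive s \<longrightarrow>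
      (\<forall>v<k. v \<in> alive s \<longrightarrow> 2 \<le> card {w \<in> alive s. {v, w} \<in> E}))"])
  have alive_counter: "alive (s(VERTEX := f)) = alive s" for s f
    by (simp add: alive_def)
  let ?I = "\<lambda>k s'. correct s' \<and> s' ROUND = s ROUND \<and>
    alive s' \<subseteq> alive s \<and> (alive s' = alive s \<longrightarrow>
    (\<forall>v<k. v \<in> alive s \<longrightarrow> 2 \<le> card {w \<in> alive s. {v, w} \<in> E}))"
  show "?I 0 (s(VERTEX := (s VERTEX)(0 := 0)))"
    using s by (simp add: correct_counter alive_counter)
  show "s 0 0 = n" if "?I k s" for k s
    using that by (simp add: correct_def ready_def)
  \<comment> \<open>Remaining sets only shrink, so equality with \<open>alive s\<close> after the
    visit implies equality before it, and the degrees recorded earlier still apply.\<close>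
  show "runs visit s1 (1 + (n * (max_time scan_body + 2) + 4 + max_time remove))
      (\<lambda>s'. s' VERTEX 0 = k \<and> ?I (Suc k) (s'(VERTEX := (s' VERTEX)(0 := Suc k))))"
    if "k < n" "?I k s1" "s1 VERTEX 0 = k" for k s1
    using that by (intro runs_mono[OF runs_visit[of s1 k]])
      (auto simp: correct_counter alive_counter less_Suc_eq)
  show "correct s' \<and> s' ROUND = s ROUND \<and> card (alive s') \<le> card (alive s) - 1"
    if I: "?I n s'" for s'
  proof -
    have fin: "finite (alive s)" by (simp add: alive_def)
    have "card (alive s') \<le> card (alive s) - 1"
    proof (cases "alive s = {}")
      case True
      then show ?thesis using I by simp
    next
      case False
      moreover have "alive s \<subseteq> {..<n}" by (auto simp: alive_def)
      ultimately obtain v where "v \<in> alive s" "card {w \<in> alive s. {v, w} \<in> E} \<le> 1"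
        using forest_leaf[OF forest] by blast
      moreover from this have "v < n" by (simp add: alive_def)
      ultimately have "alive s' \<noteq> alive s" using I by fastforce
      then have "card (alive s') < card (alive s)" using I fin by (intro psubset_card_mono) auto
      then show ?thesis by simp
    qed
    then show ?thesis using I by simp
  qed
qed simp

text \<open>After the last round nothing remains, the residual problem is trivially solvable, and
  the invariant reduces to the threshold condition of \<open>GDN_eqI\<close>.\<close>

lemma runs_rounds:
  assumes s: "correct s"
  shows "runs (for_loop ROUND (for_loop VERTEX visit)) s
      (n * (n * (1 + (n * (max_time scan_body + 2) + 4 + max_time remove) + 2) + 2 + 2) + 2)
    (\<lambda>s'. s' OUTPUT 0 = GDN {..<n} E \<sigma>)"
proof (rule runs_for_loop[where I = "\<lambda>k s. correct s \<and> card (alive s) \<le> n - k"])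
  have alive_counter: "alive (s(ROUND := f)) = alive s" for s f
    by (simp add: alive_def)
  let ?I = "\<lambda>k s. correct s \<and> card (alive s) \<le> n - k"
  have "card (alive s) \<le> card {..<n}" by (intro card_mono) (auto simp: alive_def)
  then show "?I 0 (s(ROUND := (s ROUND)(0 := 0)))"
    using s by (simp add: correct_counter alive_counter)
  show "s 0 0 = n" if "?I k s" for k s
    using that by (simp add: correct_def ready_def)
  show "runs (for_loop VERTEX visit) s
      (n * (1 + (n * (max_time scan_body + 2) + 4 + max_time remove) + 2) + 2)
      (\<lambda>s'. s' ROUND 0 = k \<and> ?I (Suc k) (s'(ROUND := (s' ROUND)(0 := Suc k))))"
    if "k < n" "?I k s" "s ROUND 0 = k" for k s
    using that by (intro runs_mono[OF runs_round]) (auto simp: correct_counter alive_counter)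
  show "s OUTPUT 0 = GDN {..<n} E \<sigma>" if I: "?I n s" for s
  proof -
    have "finite (alive s)" by (simp add: alive_def)
    then have "alive s = {}" using I by simp
    then have "solvable_forest {..<n} {} (\<lambda>_. 0) (\<lambda>_. 0) k \<longleftrightarrow> s OUTPUT 0 \<le> k" for k
      using I by (simp add: correct_def solvable_empty)
    then show ?thesis using forest \<sigma> by (intro GDN_eqI[symmetric]) (auto simp: forest_def)
  qed
qed simp

section \<open>Input encoding and setup phase\<close>

lemma \<sigma>_facts: "distinct \<sigma>" "set \<sigma> = {..<n}" "length \<sigma> = n"
  using \<sigma> distinct_card[of \<sigma>] by (simp_all add: permutations_of_set_def)

lemma length_encode: "length (encode (n, E, \<sigma>)) = 1 + n + n * n"
  by (simp add: encode_def \<sigma>_facts length_concat_map_const)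

lemma initial_memory_encode:
  defines "s \<equiv> initial_memory (encode (n, E, \<sigma>))"
  shows "s 0 0 = n"
    and "i < n \<Longrightarrow> s 0 (Suc i) = \<sigma> ! i"
    and "u < n \<Longrightarrow> v < n \<Longrightarrow> s 0 (1 + n + u * n + v) = of_bool ({u, v} \<in> E)"
    and "a \<noteq> 0 \<Longrightarrow> s a = (\<lambda>_. 0)"
proof -
  show "s 0 0 = n" "a \<noteq> 0 \<Longrightarrow> s a = (\<lambda>_. 0)"
    by (auto simp: s_def initial_memory_def encode_def)
  show "s 0 (Suc i) = \<sigma> ! i" if "i < n"
    using that \<sigma>_facts length_encode
    by (simp add: s_def initial_memory_def) (simp add: encode_def nth_append)
  let ?row = "\<lambda>u. map (\<lambda>v. if {u, v} \<in> E then 1 else 0 :: nat) [0..<n]"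
  show "s 0 (1 + n + u * n + v) = of_bool ({u, v} \<in> E)" if uv: "u < n" "v < n"
  proof -
    \<comment> \<open>The address must lie inside the encoding, since memory reads as 0 beyond
      it.\<close>
    have "u * n + v < n * n"
    proof -
      have "u * n + v < Suc u * n" using uv by simp
      also have "\<dots> \<le> n * n" using uv by (intro mult_le_mono) auto
      finally show ?thesis .
    qed
    then have "s 0 (1 + n + u * n + v) = encode (n, E, \<sigma>) ! (1 + n + u * n + v)"
      using length_encode by (simp add: s_def initial_memory_def)
    also have "\<dots> = concat (map ?row [0..<n]) ! (u * n + v)"
      by (simp add: encode_def nth_append \<sigma>_facts)
    also have "\<dots> = ?row u ! v"
      using uv by (intro nth_concat_map_const) auto
    finally show ?thesis using uv by simp
  qed
qed

lemma precedes_nth: "i < n \<Longrightarrow> j < n \<Longrightarrow> precedes \<sigma> (\<sigma> ! i) (\<sigma> ! j) \<longleftrightarrow> i < j"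
  unfolding precedes_def using \<sigma>_facts nth_eq_iff_index_eq[of \<sigma>] by (metis less_trans)

lemma runs_setup:
  assumes s0: "s0 = (initial_memory (encode (n, E, \<sigma>)))(OFFSET := (\<lambda>_. 0)(0 := n + 1))"
  shows "runs (for_loop ROUND setup_body) s0 (n * (max_time setup_body + 2) + 2) correct"
proof (rule runs_for_loop[where I = "\<lambda>k s. s 0 = s0 0 \<and>
    (\<forall>a\<in>{OUTPUT, REMOVED, MARKED, COST2, COST1}. s a = (\<lambda>_. 0)) \<and>
    s OFFSET 0 = 1 + n + k * n \<and> (\<forall>i<k. s POS (\<sigma> ! i) = i) \<and> (\<forall>u<k. s ROW u = 1 + n + u * n)"])
  let ?I = "\<lambda>k s. s 0 = s0 0 \<and>
    (\<forall>a\<in>{OUTPUT, REMOVED, MARKED, COST2, COST1}. s a = (\<lambda>_. 0)) \<and>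
    s OFFSET 0 = 1 + n + k * n \<and> (\<forall>i<k. s POS (\<sigma> ! i) = i) \<and> (\<forall>u<k. s ROW u = 1 + n + u * n)"
  have input: "s0 0 = initial_memory (encode (n, E, \<sigma>)) 0" by (simp add: s0)
  show "?I 0 (s0(ROUND := (s0 ROUND)(0 := 0)))"
    using initial_memory_encode(4) by (simp add: s0)
  show "s 0 0 = n" if "?I k s" for k s
    using that by (simp add: input initial_memory_encode)
  show "runs setup_body s (max_time setup_body)
      (\<lambda>s'. s' ROUND 0 = k \<and> ?I (Suc k) (s'(ROUND := (s' ROUND)(0 := Suc k))))"
    if k: "k < n" and I: "?I k s" and sk: "s ROUND 0 = k" for k s
  proof (rule runs_loop_free)
    have "s 0 (Suc k) = \<sigma> ! k" "s 0 0 = n"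
      using k I by (simp_all add: input initial_memory_encode)
    \<comment> \<open>The order has no repetitions, so the positions stored earlier are not
      overwritten.\<close>
    moreover have "\<sigma> ! i \<noteq> \<sigma> ! k" if "i < k" for i
      using that k \<sigma>_facts by (simp add: nth_eq_iff_index_eq)
    ultimately show "result setup_body s ROUND 0 = k \<and>
        ?I (Suc k) ((result setup_body s)(ROUND := (result setup_body s ROUND)(0 := Suc k)))"
      using I sk by (auto simp: setup_body_def less_Suc_eq)
  qed (simp add: setup_body_def)
  show "correct s" if I: "?I n s" for s
  proof -
    have "s POS u < s POS v \<longleftrightarrow> precedes \<sigma> u v" if uv: "u < n" "v < n" for u v
    proof -
      obtain i j where "i < n" "\<sigma> ! i = u" "j < n" "\<sigma> ! j = v"
        using uv \<sigma>_facts by (metis in_set_conv_nth lessThan_iff)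
      then show ?thesis using precedes_nth[of i j] I by auto
    qed
    then have "ready s"
      using I initial_memory_encode(1,3) by (simp add: ready_def input)
    moreover have "alive s = {..<n}" "marked s = {}"
      using I by (auto simp: alive_def marked_def)
    ultimately show ?thesis using I by (simp add: correct_def)
  qed
qed simp

text \<open>The coefficients collect the loop budgets: three nested loops give the cubic term, and
  the constant 5 is one initial assignment plus 2 for each of the two outer loops.\<close>

lemma runs_gdn_program:
  "runs gdn_program (initial_memory (encode (n, E, \<sigma>)))
    (poly [:5, max_time setup_body + 6, max_time remove + 7, max_time scan_body + 2:] n)
    (\<lambda>s. s OUTPUT 0 = GDN {..<n} E \<sigma>)"
proof -
  let ?init = "set_scalar OFFSET (Plus (scalar 0) (Const 1))"
  let ?s = "initial_memory (encode (n, E, \<sigma>))"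
  let ?T = "n * (n * (1 + (n * (max_time scan_body + 2) + 4 + max_time remove) + 2) + 2 + 2) + 2"
  have "result ?init ?s = ?s(OFFSET := (\<lambda>_. 0)(0 := n + 1))"
    using initial_memory_encode(1) initial_memory_encode(4)[of OFFSET] by simp
  then have "runs (for_loop ROUND setup_body) (result ?init ?s) (n * (max_time setup_body + 2) + 2)
      (\<lambda>s. runs (for_loop ROUND (for_loop VERTEX visit)) s ?T (\<lambda>s. s OUTPUT 0 = GDN {..<n} E \<sigma>))"
    by (intro runs_mono[OF runs_setup]) (use runs_rounds in auto)
  then have "runs ?init ?s (max_time ?init) (\<lambda>s. runs (Seq (for_loop ROUND setup_body)
      (for_loop ROUND (for_loop VERTEX visit))) s (n * (max_time setup_body + 2) + 2 + ?T)
      (\<lambda>s. s OUTPUT 0 = GDN {..<n} E \<sigma>))"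
    by (intro runs_loop_free runs_Seq) simp_all
  from runs_Seq[OF this] show ?thesis
    unfolding gdn_program_def by (rule runs_mono) (simp_all add: algebra_simps)
qed

end

lemma poly_nat_mono: "x \<le> y \<Longrightarrow> poly q x \<le> poly q y" for q :: "nat poly"
  by (induction q) (auto intro: add_mono mult_mono)

theorem theorem4:
  "poly_time_computable encode
     {(n, E, \<sigma>). forest {..<n} E \<and> \<sigma> \<in> permutations_of_set {..<n}}
     (\<lambda>(n, E, \<sigma>). GDN {..<n} E \<sigma>)"
  unfolding poly_time_computable_def
proof (intro exI[of _ gdn_program] exI[of _
    "[:5, max_time setup_body + 6, max_time remove + 7, max_time scan_body + 2:]"] ballI)
  fix x :: "nat \<times> nat set set \<times> nat list"
  assume x: "x \<in> {(n, E, \<sigma>). forest {..<n} E \<and> \<sigma> \<in> permutations_of_set {..<n}}"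
  obtain n E \<sigma> where eq: "x = (n, E, \<sigma>)" by (cases x)
  let ?q = "[:5, max_time setup_body + 6, max_time remove + 7, max_time scan_body + 2:]"
  interpret ordered_forest n E \<sigma> using x by unfold_locales (auto simp: eq)
  \<comment> \<open>The budget is in terms of \<open>n\<close>, whereas the model measures the input
    length. The latter is at least \<open>n\<close>, and polynomials over the natural numbers are
    monotone.\<close>
  have "poly ?q n \<le> poly ?q (length (encode x))"
    by (rule poly_nat_mono) (simp add: eq length_encode)
  then have "runs gdn_program (initial_memory (encode x)) (poly ?q (length (encode x)))
      (\<lambda>s. s 1 0 = GDN {..<n} E \<sigma>)"
    using runs_mono[OF runs_gdn_program] by (simp only: eq)
  then show "\<exists>t s. exec gdn_program (initial_memory (encode x)) t s \<and>
      t \<le> poly ?q (length (encode x)) \<and> s 1 0 = (case x of (n, E, \<sigma>) \<Rightarrow> GDN {..<n} E \<sigma>)"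
    by (simp add: runs_def eq)
qed

end
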